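(* Let $G=(V,E)$ be a simple, complete, undirected graph on $n$ vertices with nonnegative edge weights $w$. The algorithm $\mathrm{ApproxCC}$ (described in the context) returns a Hamiltonian path of $G$ whose total weight is at least $\tfrac12$ times the maximum total weight of a Hamiltonian path in $G$; that is, it is a $1/2$-approximation for $\mathsf{PathMaxTSP}$.
   Context: $\mathsf{PathMaxTSP}$: given such a graph, find a Hamiltonian path (a simple path through all vertices) of maximum total edge weight. A cycle cover of a complete graph is a set of vertex-disjoint cycles, each of length at least 2 (a cycle of length 2 on $\{x,y\}$ uses the connection between $x$ and $y$ twice), such that every vertex lies in exactly one cycle; its weight is the sum of the weights of the edges traversed. Algorithm $\mathrm{ApproxCC}$: maintain a graph $G_k$ whose vertices ("super nodes") are vertex-disjoint paths of $G$ covering $V$; initially $G_0=G$, each vertex being a one-vertex path. While $G_k$ has more than one super node: compute a maximum-weight cycle cover of $G_k$; from each cycle remove an edge of minimum weight, leaving a sequence of super nodes $p_1,\dots,p_a$ in cycle order; set $p\gets p_1$ and for $i=2,\dots,a$, letting $u$ be the last vertex of $p$ and $v_1,\dots,v_d$ be the path $p_i$, append $v_1,\dots,v_d$ to $p$ if $w(u,v_1)>w(u,v_d)$ and append $v_d,\dots,v_1$ otherwise; the resulting path $p$ becomes a super node of $G_{k+1}$. For super nodes $(u_1,\dots,u_a)$ and $(v_1,\dots,v_b)$ of $G_{k+1}$, the edge from the first to the second has weight $w(u_a,v_1)$. When a single super node remains, output the Hamiltonian path of $G$ it represents. *)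

theory Defs
  imports Complex_Main
begin

text \<open>An undirected edge is a two-element set of vertices, so a weight function
  on edges is symmetric by construction.\<close>

definition simple_complete_graph :: "'a set \<Rightarrow> 'a set set \<Rightarrow> bool" where
  "simple_complete_graph V E \<longleftrightarrow> finite V \<and> E = {e. e \<subseteq> V \<and> card e = 2}"

definition hamiltonian_path :: "'a set \<Rightarrow> 'a set set \<Rightarrow> 'a list \<Rightarrow> bool" where
  "hamiltonian_path V E p \<longleftrightarrow>
     distinct p \<and> set p = V \<and> (\<forall>i. Suc i < length p \<longrightarrow> {p ! i, p ! Suc i} \<in> E)"

definition path_weight :: "('a set \<Rightarrow> real) \<Rightarrow> 'a list \<Rightarrow> real" where
  "path_weight w p = (\<Sum>i < length p - 1. w {p ! i, p ! Suc i})"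

definition max_hamiltonian_path_weight :: "'a set \<Rightarrow> 'a set set \<Rightarrow> ('a set \<Rightarrow> real) \<Rightarrow> real" where
  "max_hamiltonian_path_weight V E w = Max (path_weight w ` {p. hamiltonian_path V E p})"

text \<open>Cycle covers of the complete graph on a vertex set \<open>S\<close>, with weights given by a
  function \<open>d\<close> of ordered pairs. The list \<open>[x\<^sub>0, \<dots>, x\<^sub>a\<^sub>-\<^sub>1]\<close> stands for the cycle
  traversing \<open>x\<^sub>0, \<dots>, x\<^sub>a\<^sub>-\<^sub>1, x\<^sub>0\<close>; its \<open>i\<close>-th edge leads from \<open>x\<^sub>i\<close> to the
  cyclically next vertex. In particular \<open>[x, y]\<close> has the two edges from \<open>x\<close> to \<open>y\<close>
  and from \<open>y\<close> to \<open>x\<close>.\<close>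

definition cycle_cover :: "'b set \<Rightarrow> 'b list set \<Rightarrow> bool" where
  "cycle_cover S C \<longleftrightarrow>
     (\<forall>c\<in>C. distinct c \<and> 2 \<le> length c \<and> set c \<subseteq> S) \<and>
     (\<forall>x\<in>S. \<exists>!c. c \<in> C \<and> x \<in> set c)"

definition cycle_edge_weight :: "('b \<Rightarrow> 'b \<Rightarrow> real) \<Rightarrow> 'b list \<Rightarrow> nat \<Rightarrow> real" where
  "cycle_edge_weight d c i = d (c ! i) (c ! (Suc i mod length c))"

definition cycle_cover_weight :: "('b \<Rightarrow> 'b \<Rightarrow> real) \<Rightarrow> 'b list set \<Rightarrow> real" where
  "cycle_cover_weight d C = (\<Sum>c\<in>C. \<Sum>i < length c. cycle_edge_weight d c i)"

text \<open>A super node is a nonempty vertex list, and a stage of the algorithm is its set of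
  super nodes. On one-vertex super nodes \<open>super_weight\<close> is the edge weight of the
  original graph, so the first stage needs no special treatment.\<close>

definition super_weight :: "('a set \<Rightarrow> real) \<Rightarrow> 'a list \<Rightarrow> 'a list \<Rightarrow> real" where
  "super_weight w p q = w {last p, hd q}"

definition append_super :: "('a set \<Rightarrow> real) \<Rightarrow> 'a list \<Rightarrow> 'a list \<Rightarrow> 'a list" where
  "append_super w p q = (if w {last p, hd q} > w {last p, last q} then p @ q else p @ rev q)"

definition merge_supers :: "('a set \<Rightarrow> real) \<Rightarrow> 'a list list \<Rightarrow> 'a list" where
  "merge_supers w ps = foldl (append_super w) (hd ps) (tl ps)"

text \<open>One loop iteration, as a relation because the maximum-weight cycle cover \<open>C\<close>
  and the minimum-weight edge (index \<open>cut c\<close>) removed from each cycle \<open>c\<close> need not be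
  unique. Deleting the edge with index \<open>i\<close> leaves the sequence \<open>rotate (Suc i) c\<close>.\<close>

definition approxCC_step :: "('a set \<Rightarrow> real) \<Rightarrow> 'a list set \<Rightarrow> 'a list set \<Rightarrow> bool" where
  "approxCC_step w S S' \<longleftrightarrow>
     card S > 1 \<and>
     (\<exists>C cut.
        is_arg_max (cycle_cover_weight (super_weight w)) (cycle_cover S) C \<and>
        (\<forall>c\<in>C. is_arg_min (cycle_edge_weight (super_weight w) c) (\<lambda>i. i < length c) (cut c)) \<and>
        S' = (\<lambda>c. merge_supers w (rotate (Suc (cut c)) c)) ` C)"

definition approxCC_init :: "'a set \<Rightarrow> 'a list set" where
  "approxCC_init V = (\<lambda>v. [v]) ` V"

definition approxCC_terminates :: "'a set \<Rightarrow> ('a set \<Rightarrow> real) \<Rightarrow> bool" where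
  "approxCC_terminates V w \<longleftrightarrow>
     \<not> (\<exists>S :: nat \<Rightarrow> 'a list set.
          S 0 = approxCC_init V \<and> (\<forall>k. approxCC_step w (S k) (S (Suc k))))"

text \<open>\<open>S\<close> is a stage at which some run stops: either the loop guard fails, or the run is
  stuck. That the latter never happens is part of what has to be shown.\<close>

definition approxCC_final :: "'a set \<Rightarrow> ('a set \<Rightarrow> real) \<Rightarrow> 'a list set \<Rightarrow> bool" where
  "approxCC_final V w S \<longleftrightarrow>
     (approxCC_step w)\<^sup>*\<^sup>* (approxCC_init V) S \<and> \<not> (\<exists>S'. approxCC_step w S S')"

end

theory Submission
  imports Defs
begin

text \<open>Closing an optimal Hamiltonian path to a cycle shows that the first maximum-weight cycle
  cover weighs at least the optimum. A cycle has at least two edges, so deleting a lightest one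
  keeps at least half of its weight; and since the super nodes of the first stage are single
  vertices, merging preserves exactly the edges that were not deleted. In all later stages,
  paths are only reversed and joined by edges of nonnegative weight, so the total weight of the
  super nodes never drops again. Every stage at least halves the number of super nodes.\<close>

subsection \<open>Weights of paths and cycles\<close>

lemma path_weight_Nil [simp]: "path_weight w [] = 0"
  and path_weight_singleton [simp]: "path_weight w [x] = 0"
  by (simp_all add: path_weight_def)

lemma path_weight_Cons_Cons [simp]:
  "path_weight w (x # y # zs) = w {x, y} + path_weight w (y # zs)"
  by (simp add: path_weight_def sum.lessThan_Suc_shift del: sum.lessThan_Suc)

lemma path_weight_append:
  assumes "p \<noteq> []" "q \<noteq> []"
  shows "path_weight w (p @ q) = path_weight w p + w {last p, hd q} + path_weight w q"
  using assms(1)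
proof (induction p rule: list_nonempty_induct)
  case (single x)
  then show ?case using assms(2) by (cases q) auto
next
  case (cons x xs)
  then show ?case by (cases xs) auto
qed

text \<open>Edges are sets, so reading a path backwards meets the same edges. This lets a super node
  be appended in either orientation.\<close>

lemma path_weight_rev: "path_weight w (rev p) = path_weight w p"
proof (induction p)
  case (Cons x p)
  show ?case
  proof (cases "p = []")
    case False
    have "path_weight w (x # p) = w {x, hd p} + path_weight w p"
      using False by (cases p) simp_all
    then show ?thesis
      using False Cons.IH by (simp add: path_weight_append last_rev insert_commute)
  qed simp
qed simp

text \<open>Rotating a cycle by one only shifts its edge indices cyclically. The lemma allows a
  cycle to be opened at any chosen edge without changing the total.\<close>

lemma cycle_weight_rotate:
  "(\<Sum>i<length c. cycle_edge_weight d (rotate k c) i) = (\<Sum>i<length c. cycle_edge_weight d c i)"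
proof (induction k)
  case (Suc k)
  let ?c = "rotate k c"
  have "(\<Sum>i<length c. cycle_edge_weight d (rotate1 ?c) i) = (\<Sum>i<length c. cycle_edge_weight d ?c i)"
  proof (cases "length c")
    case (Suc n)
    have "cycle_edge_weight d (rotate1 ?c) i = cycle_edge_weight d ?c (Suc i mod Suc n)"
      if "i < Suc n" for i
      using that Suc by (simp add: cycle_edge_weight_def nth_rotate1)
    then have "(\<Sum>i<length c. cycle_edge_weight d (rotate1 ?c) i)
        = (\<Sum>i<Suc n. cycle_edge_weight d ?c (Suc i mod Suc n))"
      using Suc by simp
    \<comment> \<open>Only the last index \<open>n\<close> wraps around, to edge
      \<open>0\<close>.\<close>
    also have "\<dots> = (\<Sum>i<n. cycle_edge_weight d ?c (Suc i)) + cycle_edge_weight d ?c 0"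
      by simp
    also have "\<dots> = (\<Sum>i<Suc n. cycle_edge_weight d ?c i)"
      by (subst sum.lessThan_Suc_shift) simp
    finally show ?thesis using Suc by simp
  qed simp
  then show ?case using Suc.IH by simp
qed simp

text \<open>Links the two notions of weight: once for closing an optimal path, once for opening a
  cycle at its lightest edge.\<close>

lemma cycle_weight_eq_path_weight:
  assumes "vs \<noteq> []"
  shows "(\<Sum>i<length vs. cycle_edge_weight (super_weight w) (map (\<lambda>v. [v]) vs) i)
    = path_weight w vs + w {last vs, hd vs}"
proof -
  obtain n where n: "length vs = Suc n"
    using assms by (cases vs) auto
  then show ?thesis
    using assms
    by (simp add: path_weight_def cycle_edge_weight_def super_weight_def last_conv_nth hd_conv_nth)
qed

subsection \<open>Cycle covers\<close>

lemma cycle_cover_UN: "cycle_cover S C \<Longrightarrow> \<Union> (set ` C) = S"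
  unfolding cycle_cover_def by blast

lemma cycle_cover_disjoint:
  "cycle_cover S C \<Longrightarrow> c \<in> C \<Longrightarrow> c' \<in> C \<Longrightarrow> c \<noteq> c' \<Longrightarrow> set c \<inter> set c' = {}"
  unfolding cycle_cover_def by blast

lemma finite_cycle_covers: "finite S \<Longrightarrow> finite {C. cycle_cover S C}"
  by (rule finite_subset[of _ "Pow {c. set c \<subseteq> S \<and> distinct c}"])
    (auto simp: cycle_cover_def finite_subset_distinct)

lemma cycle_cover_finite: "finite S \<Longrightarrow> cycle_cover S C \<Longrightarrow> finite C"
  by (rule finite_subset[of _ "{c. set c \<subseteq> S \<and> distinct c}"])
    (auto simp: cycle_cover_def finite_subset_distinct)

lemma cycle_cover_single:
  "distinct c \<Longrightarrow> 2 \<le> length c \<Longrightarrow> cycle_cover (set c) {c}"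
  by (auto simp: cycle_cover_def)

text \<open>Grouping super nodes by cycle serves both counting (\<open>f\<close> constantly 1) and
  comparing total path weights across a step.\<close>

lemma cycle_cover_sum:
  assumes "finite S" "cycle_cover S C"
  shows "sum f S = (\<Sum>c\<in>C. sum f (set c))"
proof -
  have "sum f (\<Union> (set ` C)) = (\<Sum>c\<in>C. sum f (set c))"
    using cycle_cover_finite[OF assms] cycle_cover_disjoint[OF assms(2)]
    by (intro sum.UNION_disjoint) auto
  then show ?thesis using cycle_cover_UN[OF assms(2)] by simp
qed

lemma cycle_cover_card:
  assumes "finite S" "cycle_cover S C"
  shows "2 * card C \<le> card S"
proof -
  have "(\<Sum>c\<in>C. 2) \<le> (\<Sum>c\<in>C. card (set c))"
    using assms(2) by (intro sum_mono) (auto simp: cycle_cover_def distinct_card)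
  also have "\<dots> = card S"
    using cycle_cover_sum[OF assms, of "\<lambda>_. 1 :: nat"] by simp
  finally show ?thesis by simp
qed

text \<open>There are finitely many covers, and one cycle through all of \<open>S\<close> is among
  them because \<open>S\<close> has at least two elements.\<close>

lemma ex_max_cycle_cover:
  assumes "card S > 1"
  shows "\<exists>C. is_arg_max (cycle_cover_weight d) (cycle_cover S) C"
proof -
  \<comment> \<open>An infinite set has \<open>card\<close> equal to 0, so the bound on
    \<open>card S\<close> forces finiteness.\<close>
  have fin: "finite S" using assms card.infinite by fastforce
  then obtain c where "set c = S" "distinct c"
    using finite_distinct_list by blast
  then have "cycle_cover S {c}"
    using cycle_cover_single[of c] assms distinct_card[of c] by simp
  then have ne: "{C. cycle_cover S C} \<noteq> {}" by blast
  obtain C where "is_arg_min (\<lambda>C. - cycle_cover_weight d C) (\<lambda>C. C \<in> {C. cycle_cover S C}) C"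
    using ex_is_arg_min_if_finite[OF finite_cycle_covers[OF fin] ne] by blast
  then have "is_arg_max (cycle_cover_weight d) (cycle_cover S) C"
    by (auto simp: is_arg_min_def is_arg_max_def)
  then show ?thesis ..
qed

section \<open>Progress and termination of the loop\<close>

text \<open>Excludes runs that get stuck while the loop guard holds: a best cover exists, and each
  of its cycles has edges, hence a lightest one.\<close>

lemma approxCC_step_exists:
  assumes "card S > 1"
  shows "\<exists>S'. approxCC_step w S S'"
proof -
  obtain C where C: "is_arg_max (cycle_cover_weight (super_weight w)) (cycle_cover S) C"
    using ex_max_cycle_cover[OF assms] by blast
  have "\<exists>i. is_arg_min (cycle_edge_weight (super_weight w) c) (\<lambda>i. i < length c) i"
    if "c \<in> C" for c
  proof -
    have "{..<length c} \<noteq> {}"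
      using C that by (auto simp: is_arg_max_def cycle_cover_def lessThan_empty_iff)
    from ex_is_arg_min_if_finite[OF finite_lessThan this] show ?thesis by simp
  qed
  then obtain cut where
    "\<forall>c\<in>C. is_arg_min (cycle_edge_weight (super_weight w) c) (\<lambda>i. i < length c) (cut c)"
    by metis
  then show ?thesis
    using C assms unfolding approxCC_step_def by blast
qed

lemma approxCC_step_card:
  assumes "approxCC_step w S S'"
  shows "card S' < card S"
proof -
  from assms obtain C f where C: "cycle_cover S C" "S' = f ` C" and S: "card S > 1"
    unfolding approxCC_step_def is_arg_max_def by blast
  have fin: "finite S" using S card.infinite by fastforce
  have "card S' \<le> card C"
    using C(2) cycle_cover_finite[OF fin C(1)] card_image_le by blast
  then show ?thesis
    using cycle_cover_card[OF fin C(1)] S by linarith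
qed

lemma approxCC_terminates: "approxCC_terminates V w"
  unfolding approxCC_terminates_def
proof clarify
  fix S :: "nat \<Rightarrow> 'a list set"
  assume "\<forall>k. approxCC_step w (S k) (S (Suc k))"
  then have less: "card (S (Suc k)) < card (S k)" for k
    using approxCC_step_card by blast
  \<comment> \<open>Each step loses at least one super node, which cannot go on for more than
    \<open>card (S 0)\<close> steps.\<close>
  have "card (S k) + k \<le> card (S 0)" for k
  proof (induction k)
    case (Suc k)
    then show ?case using less[of k] by simp
  qed simp
  from this[of "Suc (card (S 0))"] show False by simp
qed

subsection \<open>Stages of the algorithm\<close>

text \<open>The loop invariant. Edges need no mention, since in a complete graph every
  duplicate-free vertex list is a path.\<close>

definition path_partition :: "'a set \<Rightarrow> 'a list set \<Rightarrow> bool" where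
  "path_partition V S \<longleftrightarrow>
     finite S \<and> (\<forall>p\<in>S. p \<noteq> [] \<and> distinct p) \<and>
     (\<forall>p\<in>S. \<forall>q\<in>S. p \<noteq> q \<longrightarrow> set p \<inter> set q = {}) \<and> \<Union> (set ` S) = V"

text \<open>The condition \<open>x \<noteq> y\<close> matters: \<open>{x, x}\<close> is a singleton
  and no edge, and \<open>w\<close> is unconstrained there.\<close>

definition nonneg_on :: "'a set \<Rightarrow> ('a set \<Rightarrow> real) \<Rightarrow> bool" where
  "nonneg_on V w \<longleftrightarrow> (\<forall>x\<in>V. \<forall>y\<in>V. x \<noteq> y \<longrightarrow> 0 \<le> w {x, y})"

lemma nonneg_onD: "nonneg_on V w \<Longrightarrow> x \<in> V \<Longrightarrow> y \<in> V \<Longrightarrow> x \<noteq> y \<Longrightarrow> 0 \<le> w {x, y}"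
  by (simp add: nonneg_on_def)

lemma path_partition_init: "finite V \<Longrightarrow> path_partition V (approxCC_init V)"
  by (auto simp: path_partition_def approxCC_init_def)

text \<open>Whichever orientation is chosen, an append keeps all edges of both paths and adds one
  joining edge of nonnegative weight.\<close>

lemma merge_supers_properties:
  assumes "nonneg_on V w"
    and "ps \<noteq> []" "[] \<notin> set ps" "distinct (concat ps)" "set (concat ps) \<subseteq> V"
  shows "distinct (merge_supers w ps) \<and> set (merge_supers w ps) = set (concat ps) \<and>
    sum_list (map (path_weight w) ps) \<le> path_weight w (merge_supers w ps)"
proof -
  \<comment> \<open>Generalised over the accumulator \<open>p\<close> of the fold, which starts as
    \<open>hd ps\<close>.\<close>
  have "distinct (foldl (append_super w) p qs) \<and>
      set (foldl (append_super w) p qs) = set (concat (p # qs)) \<and>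
      sum_list (map (path_weight w) (p # qs)) \<le> path_weight w (foldl (append_super w) p qs)"
    if "[] \<notin> set (p # qs)" "distinct (concat (p # qs))" "set (concat (p # qs)) \<subseteq> V" for p qs
    using that
  proof (induction qs arbitrary: p)
    case (Cons q qs)
    let ?r = "append_super w p q"
    have ne: "p \<noteq> []" "q \<noteq> []" using Cons.prems by auto
    have "last p \<in> set p" "hd q \<in> set q" "last q \<in> set q" using ne by simp_all
    \<comment> \<open>The two lists are disjoint, so both candidate joining pairs are genuine
      edges.\<close>
    then have w: "0 \<le> w {last p, hd q}" "0 \<le> w {last p, last q}"
      using Cons.prems by (auto intro!: nonneg_onD[OF assms(1)])
    have set: "set ?r = set p \<union> set q" and r: "?r \<noteq> []"
      using ne by (auto simp: append_super_def)
    have dist: "distinct ?r" using Cons.prems by (auto simp: append_super_def)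
    have "path_weight w p + path_weight w q \<le> path_weight w ?r"
      using ne w by (simp add: append_super_def path_weight_append path_weight_rev hd_rev)
    moreover have "distinct (foldl (append_super w) ?r qs) \<and>
      set (foldl (append_super w) ?r qs) = set (concat (?r # qs)) \<and>
      sum_list (map (path_weight w) (?r # qs)) \<le> path_weight w (foldl (append_super w) ?r qs)"
      using Cons.prems r set dist by (intro Cons.IH) auto
    ultimately show ?case using set by auto
  qed simp
  from this[of "hd ps" "tl ps"] show ?thesis
    using assms(2-) by (simp add: merge_supers_def)
qed

text \<open>Reversing a one-vertex path does nothing, so both branches of
  \<open>append_super\<close> agree and the cycle order survives.\<close>

lemma merge_supers_singletons:
  assumes "vs \<noteq> []"
  shows "merge_supers w (map (\<lambda>v. [v]) vs) = vs"
proof -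
  have "foldl (append_super w) p (map (\<lambda>v. [v]) us) = p @ us" for p us
    by (induction us arbitrary: p) (simp_all add: append_super_def)
  then show ?thesis using assms by (cases vs) (simp_all add: merge_supers_def)
qed

lemma merge_cycle_properties:
  assumes "nonneg_on V w"
    and "path_partition V S" "cycle_cover S C" "c \<in> C"
  shows "distinct (merge_supers w (rotate k c)) \<and>
    set (merge_supers w (rotate k c)) = \<Union> (set ` set c) \<and>
    (\<Sum>p\<in>set c. path_weight w p) \<le> path_weight w (merge_supers w (rotate k c))"
proof -
  have c: "distinct c" "c \<noteq> []" "set c \<subseteq> S"
    using assms(3,4) by (auto simp: cycle_cover_def)
  have "set p \<inter> set q = {}" if "p \<in> set c" "q \<in> set c" "p \<noteq> q" for p q
    using that c(3) assms(2) unfolding path_partition_def by blast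
  moreover have "distinct p" if "p \<in> set c" for p
    using that c(3) assms(2) unfolding path_partition_def by blast
  ultimately have "distinct (concat (rotate k c))"
    using c(1) by (intro distinct_concat) simp_all
  then have "distinct (merge_supers w (rotate k c)) \<and>
    set (merge_supers w (rotate k c)) = set (concat (rotate k c)) \<and>
    sum_list (map (path_weight w) (rotate k c)) \<le> path_weight w (merge_supers w (rotate k c))"
    using c assms(2) unfolding path_partition_def
    by (intro merge_supers_properties[where V = V] assms(1)) auto
  then show ?thesis
    using c(1) by (simp add: sum_list_distinct_conv_sum_set)
qed

text \<open>Different cycles hold disjoint sets of vertices, so their merged paths are disjoint and,
  being nonempty, different. Injectivity matters because a stage is a set: no two cycles collapse to
  one summand.\<close>

lemma merge_cycles_partition:
  fixes w :: "'a set \<Rightarrow> real" and cut :: "'a list list \<Rightarrow> nat"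
  assumes "nonneg_on V w"
    and "path_partition V S" "cycle_cover S C"
  defines "m \<equiv> \<lambda>c. merge_supers w (rotate (Suc (cut c)) c)"
  shows "path_partition V (m ` C)" and "inj_on m C"
proof -
  have m: "distinct (m c) \<and> set (m c) = \<Union> (set ` set c)" if "c \<in> C" for c
    using merge_cycle_properties[OF assms(1-3) that] unfolding m_def by blast
  have cov: "\<Union> (set ` C) = S" by (rule cycle_cover_UN[OF assms(3)])
  have fin: "finite S" using assms(2) by (simp add: path_partition_def)
  have ne: "m c \<noteq> []" if "c \<in> C" for c
  proof -
    have "hd c \<in> set c" using assms(3) that by (intro hd_in_set) (auto simp: cycle_cover_def)
    then have "hd c \<noteq> []" using assms(2) cov that unfolding path_partition_def by blast
    then show ?thesis using m[OF that] \<open>hd c \<in> set c\<close> by fastforce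
  qed
  have disj: "set (m c) \<inter> set (m c') = {}" if "c \<in> C" "c' \<in> C" "c \<noteq> c'" for c c'
  proof -
    have "set p \<inter> set q = {}" if "p \<in> set c" "q \<in> set c'" for p q
    proof -
      have "p \<in> S" "q \<in> S" "p \<noteq> q"
        using that \<open>c \<in> C\<close> \<open>c' \<in> C\<close> cov cycle_cover_disjoint[OF assms(3) \<open>c \<in> C\<close> \<open>c' \<in> C\<close> \<open>c \<noteq> c'\<close>]
        by auto
      then show ?thesis using assms(2) by (simp add: path_partition_def)
    qed
    then show ?thesis using m that by blast
  qed
  show "inj_on m C"
  proof (rule inj_onI, rule ccontr)
    fix c c' assume "c \<in> C" "c' \<in> C" "m c = m c'" "c \<noteq> c'"
    then show False using disj[of c c'] ne[of c] by simp
  qed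
  have "\<Union> (set ` m ` C) = V"
    using m cov assms(2) by (auto simp: path_partition_def)
  moreover have "\<forall>p\<in>m ` C. \<forall>q\<in>m ` C. p \<noteq> q \<longrightarrow> set p \<inter> set q = {}"
    using disj by blast
  ultimately show "path_partition V (m ` C)"
    using m ne cycle_cover_finite[OF fin assms(3)] by (simp add: path_partition_def)
qed

text \<open>Group the old super nodes by cycle, use that merging loses no weight within a cycle, and
  reindex by injectivity.\<close>

lemma approxCC_step_invariant:
  assumes w: "nonneg_on V w"
    and S: "path_partition V S" and step: "approxCC_step w S S'"
  shows "path_partition V S' \<and> (\<Sum>p\<in>S. path_weight w p) \<le> (\<Sum>p\<in>S'. path_weight w p)"
proof -
  obtain C cut where C: "cycle_cover S C"
    and S': "S' = (\<lambda>c. merge_supers w (rotate (Suc (cut c)) c)) ` C"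
    using step unfolding approxCC_step_def is_arg_max_def by blast
  have fin: "finite S" using S by (simp add: path_partition_def)
  note part = merge_cycles_partition[where cut = cut, OF w S C]
  have "(\<Sum>p\<in>S. path_weight w p) = (\<Sum>c\<in>C. \<Sum>p\<in>set c. path_weight w p)"
    by (rule cycle_cover_sum[OF fin C])
  also have "\<dots> \<le> (\<Sum>c\<in>C. path_weight w (merge_supers w (rotate (Suc (cut c)) c)))"
    using merge_cycle_properties[OF w S C] by (intro sum_mono) blast
  also have "\<dots> = (\<Sum>p\<in>S'. path_weight w p)"
    using part(2) by (simp add: S' sum.reindex)
  finally show ?thesis using part(1) S' by simp
qed

lemma approxCC_steps_invariant:
  assumes w: "nonneg_on V w"
    and steps: "(approxCC_step w)\<^sup>*\<^sup>* S S'" and S: "path_partition V S"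
  shows "path_partition V S' \<and> (\<Sum>p\<in>S. path_weight w p) \<le> (\<Sum>p\<in>S'. path_weight w p)"
  using steps
proof (induction rule: rtranclp_induct)
  case (step T U)
  then show ?case using approxCC_step_invariant[OF w _ step.hyps(2)] by force
qed (use S in simp)

subsection \<open>The first stage\<close>

text \<open>This is where the factor 2 arises: the lightest of at least two edges carries at most
  half of the cycle, and the merged path consists of all the others.\<close>

lemma cut_singleton_cycle_weight:
  assumes w: "nonneg_on V w"
    and c: "distinct c" "2 \<le> length c" "set c \<subseteq> approxCC_init V"
    and i: "is_arg_min (cycle_edge_weight (super_weight w) c) (\<lambda>i. i < length c) i"
  shows "(\<Sum>j<length c. cycle_edge_weight (super_weight w) c j)
    \<le> 2 * path_weight w (merge_supers w (rotate (Suc i) c))"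
proof -
  let ?e = "cycle_edge_weight (super_weight w) c"
  \<comment> \<open>The vertices of the cycle read from just behind the removed edge, which thereby
    becomes the closing edge from \<open>last vs\<close> to \<open>hd vs\<close>.\<close>
  define vs where "vs = rotate (Suc i) (map hd c)"
  have i_less: "i < length c" and i_min: "\<And>j. j < length c \<Longrightarrow> ?e i \<le> ?e j"
    using i by (auto simp: is_arg_min_linorder)
  have sing: "map (\<lambda>v. [v]) (map hd c) = c"
    using c(3) by (auto simp: approxCC_init_def intro!: map_idI)
  then have rot: "rotate (Suc i) c = map (\<lambda>v. [v]) vs"
    unfolding vs_def by (metis rotate_map)
  have vs: "vs \<noteq> []" "length vs = length c" using c(2) by (auto simp: vs_def)
  have nth_sing: "c ! j = [hd (c ! j)]" if "j < length c" for j
    using that sing by (metis length_map nth_map)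
  have last: "last vs = hd (c ! i)"
  proof -
    have "Suc i + (length c - 1) = i + length c" using i_less by simp
    moreover have "last (rotate (Suc i) c) = c ! ((Suc i + (length c - 1)) mod length c)"
      using i_less nth_rotate[of "length c - 1" c "Suc i"]
      by (subst last_conv_nth) (auto simp del: rotate_Suc)
    ultimately have "last (rotate (Suc i) c) = c ! i"
      using i_less by simp
    then show ?thesis using rot vs(1) by (metis last_map list.sel(1))
  qed
  have Suc_less: "Suc i mod length c < length c" using i_less by (intro mod_less_divisor) linarith
  have hd: "hd vs = hd (c ! (Suc i mod length c))"
  proof -
    have "map hd c \<noteq> []" using i_less by auto
    from hd_rotate_conv_nth[OF this, of "Suc i"] show ?thesis
      using Suc_less by (simp add: vs_def del: rotate_Suc)
  qed
  have e_i: "?e i = w {last vs, hd vs}"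
    using last hd nth_sing[OF i_less] nth_sing[OF Suc_less]
    by (simp add: cycle_edge_weight_def super_weight_def) (metis last.simps)
  \<comment> \<open>Length at least 2 ensures that the removed edge joins two different vertices, so
    that its weight is nonnegative.\<close>
  have "Suc i mod length c \<noteq> i"
    using i_less c(2) by (cases "Suc i = length c") auto
  then have "c ! (Suc i mod length c) \<noteq> c ! i"
    using c(1) i_less Suc_less by (simp add: nth_eq_iff_index_eq)
  then have "hd (c ! (Suc i mod length c)) \<noteq> hd (c ! i)"
    using nth_sing[OF i_less] nth_sing[OF Suc_less] by metis
  moreover have "hd (c ! j) \<in> V" if "j < length c" for j
    using c(3) nth_mem[OF that] by (auto simp: approxCC_init_def)
  ultimately have nonneg: "0 \<le> ?e i"
    using e_i last hd nonneg_onD[OF w] i_less Suc_less by metis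
  have total: "(\<Sum>j<length c. ?e j) = path_weight w vs + ?e i"
    using cycle_weight_rotate[of "super_weight w" "Suc i" c] cycle_weight_eq_path_weight[OF vs(1), of w]
    by (simp add: rot vs(2) e_i del: rotate_Suc)
  \<comment> \<open>Nonnegativity of the lightest edge allows its multiplicity to be lowered from
    \<open>length c\<close> to 2.\<close>
  have "2 * ?e i \<le> real (length c) * ?e i"
    using c(2) nonneg by (intro mult_right_mono) auto
  also have "\<dots> \<le> (\<Sum>j<length c. ?e j)"
    using i_min sum_bounded_below[of "{..<length c}" "?e i" ?e] by simp
  finally show ?thesis
    using total by (simp add: rot merge_supers_singletons[OF vs(1)] del: rotate_Suc)
qed

text \<open>Any Hamiltonian path \<open>p\<close>, closed to a cycle, competes with the chosen
  cover, so the bound holds for all \<open>p\<close> before any maximum is taken.\<close>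

lemma approxCC_first_step_weight:
  assumes w: "nonneg_on V w"
    and fin: "finite V" and step: "approxCC_step w (approxCC_init V) S"
    and p: "distinct p" "set p = V"
  shows "path_weight w p \<le> 2 * (\<Sum>q\<in>S. path_weight w q)"
proof -
  let ?W = "cycle_cover_weight (super_weight w)"
  obtain C cut where arg_max: "is_arg_max ?W (cycle_cover (approxCC_init V)) C"
    and cut: "\<forall>c\<in>C. is_arg_min (cycle_edge_weight (super_weight w) c) (\<lambda>i. i < length c) (cut c)"
    and S: "S = (\<lambda>c. merge_supers w (rotate (Suc (cut c)) c)) ` C"
    using step unfolding approxCC_step_def by blast
  have C: "cycle_cover (approxCC_init V) C" using arg_max by (simp add: is_arg_max_def)
  have "card (approxCC_init V) = card V"
    unfolding approxCC_init_def by (intro card_image) (simp add: inj_on_def)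
  \<comment> \<open>The guard of the executed step supplies the two vertices that a cycle
    needs.\<close>
  then have len: "2 \<le> length p"
    using step p distinct_card[of p] by (simp add: approxCC_step_def)
  then have ne: "p \<noteq> []" by auto
  let ?c = "map (\<lambda>v. [v]) p"
  have "cycle_cover (set ?c) {?c}"
    using p len by (intro cycle_cover_single) (auto simp: distinct_map inj_on_def)
  then have cc: "cycle_cover (approxCC_init V) {?c}" using p by (simp add: approxCC_init_def)
  have "last p \<noteq> hd p"
    using len p(1) by (cases p) auto
  then have "0 \<le> w {last p, hd p}" using ne p by (intro nonneg_onD[OF w]) auto
  then have "path_weight w p \<le> ?W {?c}"
    using cycle_weight_eq_path_weight[OF ne, of w] by (simp add: cycle_cover_weight_def)
  \<comment> \<open>\<open>is_arg_max\<close> only says that no cover is strictly heavier; linearity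
    of the order turns this into an upper bound.\<close>
  also have "\<dots> \<le> ?W C" using arg_max cc by (auto simp: is_arg_max_def not_less)
  also have "\<dots> \<le> (\<Sum>c\<in>C. 2 * path_weight w (merge_supers w (rotate (Suc (cut c)) c)))"
    unfolding cycle_cover_weight_def
    using C cut by (intro sum_mono cut_singleton_cycle_weight[OF w]) (auto simp: cycle_cover_def)
  also have "\<dots> = 2 * (\<Sum>q\<in>S. path_weight w q)"
    using merge_cycles_partition(2)[where cut = cut, OF w path_partition_init[OF fin] C]
    by (simp add: S sum.reindex sum_distrib_left)
  finally show ?thesis .
qed

section \<open>The approximation guarantee\<close>

text \<open>Consecutive entries of a duplicate-free list differ, hence are adjacent by completeness.
  Hamiltonian paths are thus the orderings of \<open>V\<close>.\<close>

lemma hamiltonian_path_iff: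
  assumes "simple_complete_graph V E"
  shows "hamiltonian_path V E p \<longleftrightarrow> distinct p \<and> set p = V"
proof -
  have "{p ! i, p ! Suc i} \<in> E" if "distinct p" "set p = V" "Suc i < length p" for i
  proof -
    have "p ! i \<noteq> p ! Suc i" "p ! i \<in> V" "p ! Suc i \<in> V"
      using that by (auto simp: nth_eq_iff_index_eq)
    then show ?thesis using assms by (simp add: simple_complete_graph_def)
  qed
  then show ?thesis by (auto simp: hamiltonian_path_def)
qed

theorem theorem4p7:
  fixes V :: "'a set" and E :: "'a set set" and w :: "'a set \<Rightarrow> real"
  assumes "simple_complete_graph V E"
    and "V \<noteq> {}"
    and "\<forall>e\<in>E. 0 \<le> w e"
  shows "approxCC_terminates V w \<and>
    (\<forall>S. approxCC_final V w S \<longrightarrow>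
      (\<exists>p. S = {p} \<and> hamiltonian_path V E p \<and>
           path_weight w p \<ge> 1 / 2 * max_hamiltonian_path_weight V E w))"
proof (intro conjI allI impI)
  show "approxCC_terminates V w" by (rule approxCC_terminates)
next
  fix S assume "approxCC_final V w S"
  then have steps: "(approxCC_step w)\<^sup>*\<^sup>* (approxCC_init V) S"
    and stuck: "\<not> (\<exists>S'. approxCC_step w S S')"
    by (auto simp: approxCC_final_def)
  have fin: "finite V" using assms(1) by (simp add: simple_complete_graph_def)
  have w: "nonneg_on V w"
    using assms(1,3) by (simp add: nonneg_on_def simple_complete_graph_def)
  note ham = hamiltonian_path_iff[OF assms(1)]
  have part: "path_partition V S"
    using approxCC_steps_invariant[OF w steps path_partition_init[OF fin]] by blast
  have "card S \<le> 1" using stuck approxCC_step_exists by (metis not_le)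
  moreover have "S \<noteq> {}" "finite S" using part assms(2) by (auto simp: path_partition_def)
  ultimately have "card S = 1" by (metis card_0_eq le_antisym less_one not_le)
  then obtain p where p: "S = {p}" by (rule card_1_singletonE)
  have p_ham: "hamiltonian_path V E p"
    using part p by (simp add: ham path_partition_def)
  \<comment> \<open>The run is split at its first step: that step yields the factor 2, and the rest
    loses no weight. An empty run means a single vertex, where all path weights are 0.\<close>
  have bound: "path_weight w q \<le> 2 * path_weight w p" if q: "distinct q" "set q = V" for q
    using steps
  proof (cases rule: converse_rtranclpE)
    case base
    then have "p \<in> approxCC_init V" using p by simp
    then have "V = set p" "length p = 1"
      using p_ham by (auto simp: ham approxCC_init_def)
    then have "length q = 1" using p_ham q by (metis distinct_card ham)
    then show ?thesis using \<open>length p = 1\<close> by (simp add: path_weight_def)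
  next
    case (step T)
    have "path_partition V T"
      using approxCC_step_invariant[OF w path_partition_init[OF fin] step(1)] by blast
    then have "(\<Sum>r\<in>T. path_weight w r) \<le> path_weight w p"
      using approxCC_steps_invariant[OF w step(2)] p by simp
    then show ?thesis
      using approxCC_first_step_weight[OF w fin step(1) q] by linarith
  qed
  have ham_set: "{q. hamiltonian_path V E q} = {q. distinct q \<and> set q = V}"
    by (simp add: ham)
  have "finite {q. distinct q \<and> set q = V}"
    by (rule finite_subset[OF _ finite_subset_distinct[OF fin]]) auto
  \<comment> \<open>The output \<open>p\<close> itself shows that the maximum ranges over a nonempty
    set.\<close>
  then have "max_hamiltonian_path_weight V E w \<le> 2 * path_weight w p"
    unfolding max_hamiltonian_path_weight_def ham_set
    using p_ham bound by (intro Max.boundedI finite_imageI) (auto simp: ham)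
  then show "\<exists>p. S = {p} \<and> hamiltonian_path V E p \<and>
      path_weight w p \<ge> 1 / 2 * max_hamiltonian_path_weight V E w"
    using p p_ham by auto
qed

end
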